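(* Consider an economy where agents have linear utility functions with gradients $\mathbf{c}^1,\dots,\mathbf{c}^n$, and an elementary reallocation problem (ERP) between two agents $h\neq k$ over two commodities $i\neq j$, starting from a feasible allocation $\mathbf{x}^t=\mathbf{x}$. Let $\Gamma$ be the set of integer points in the interval $[a^{down},a^{up}]$, where $$a^{down}=\min\{\operatorname{argmax}_\alpha \alpha\,\mathbf{c}^kS^{kh}_{ij},\ \operatorname{argmax}_\alpha \alpha\,\mathbf{c}^hS^{kh}_{ij}\},\qquad a^{up}=\max\{\operatorname{argmax}_\alpha \alpha\,\mathbf{c}^kS^{kh}_{ij},\ \operatorname{argmax}_\alpha \alpha\,\mathbf{c}^hS^{kh}_{ij}\},$$ and let $[\alpha^{down},\alpha^{up}]$ be the interval of feasible step lengths, $$\alpha^{down}=-\frac{\max\{x^h_i/(p_jd^k),\,x^k_j/(p_id^h)\}}{F},\qquad \alpha^{up}=\frac{\min\{x^h_j/(p_id^k),\,x^k_i/(p_jd^h)\}}{F}.$$ Then either $\Gamma=\mathbb{Z}$ or $\Gamma=\varnothing$: $\Gamma=\mathbb{Z}$ in the case that $(c^h_ip_jd^k-c^h_jp_id^k)$ and $(c^k_jp_id^h-c^k_ip_jd^h)$ have opposite signs, whereas $\Gamma=\varnothing$ if they have the same sign. Moreover, the set $\mathcal{V}^*$ of Pareto efficient solutions of the ERP may contain at most one point: (i) If there is at least one nonzero integer between $-\max\{x^h_i/(p_jd^k),x^k_j/(p_id^h)\}/F$ and $\min\{x^h_j/(p_id^k),x^k_i/(p_jd^h)\}/F$, and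 $\Gamma=\varnothing$, then $\mathcal{V}^*$ only contains the unique point corresponding to the allocation $\mathbf{x}^{t+1}=\mathbf{x}^t+\alpha S^{kh}_{ij}$ for a step length $\alpha$ which is either equal to $-\max\{x^h_i/(p_jd^k),x^k_j/(p_id^h)\}/F$ (if $(c^h_ip_jd^k-c^h_jp_id^k)$ and $(c^k_jp_id^h-c^k_ip_jd^h)$ are negative) or equal to $\min\{x^h_j/(p_id^k),x^k_i/(p_jd^h)\}/F$ (if $(c^h_ip_jd^k-c^h_jp_id^k)$ and $(c^k_jp_id^h-c^k_ip_jd^h)$ are positive). (ii) In the opposite case, $\mathcal{V}^*$ only contains the disagreement point, i.e. the point $[u^h(\mathbf{x}),u^k(\mathbf{x})]$ given by the current allocation.
   Context: There are $n$ agents and $m$ commodities; $x^h_i$ is the amount of commodity $i$ held by agent $h$, and $\mathbf{x}=(x^h_i)\in\mathbb{R}^{mn}$. The prices $p_1,\dots,p_m$ and weights $d^1,\dots,d^n$ are positive rationals. Feasible allocations are nonnegative integer vectors $\mathbf{x}$ satisfying $\sum_i p_ix^h_i=b^h$ for each agent $h$ and $\sum_h d^hx^h_i=b^0_i$ for each commodity $i$, for given rational constants $b^h,b^0_i$. The utility of agent $l$ depends only on the agent's own bundle: $u^l(\mathbf{x})=\sum_r c^l_rx^l_r$. For agents $h\ne k$ and commodities $i\ne j$, the direction $\Delta^{kh}_{ij}\in\mathbb{R}^{mn}$ has entries $p_jd^k$ at position $(h,i)$, $-p_id^k$ at $(h,j)$, $-p_jd^h$ at $(k,i)$, $p_id^h$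 at $(k,j)$ (positions are (agent, commodity)) and $0$ elsewhere. $F=F(p_i,p_j,d^k,d^h)>0$ is the positive rational factor such that $S^{kh}_{ij}=F\,\Delta^{kh}_{ij}$ is the nonzero integer vector of smallest norm that is a positive multiple of $\Delta^{kh}_{ij}$. Here $\mathbf{c}^lS^{kh}_{ij}$ denotes the product of $\mathbf{c}^l$ with agent $l$'s block of $S^{kh}_{ij}$. The argmax of the linear function $\alpha\mapsto\alpha\,\mathbf{c}^lS^{kh}_{ij}$ is over all real $\alpha$ and is understood as $+\infty$ or $-\infty$ according to the sign of the slope; the interval $[a^{down},a^{up}]$ contains no integer when both argmaxes are the same infinity, and contains all integers when they are opposite infinities. The interval $[\alpha^{down},\alpha^{up}]$ in the claim is the range of step lengths given for keeping $\mathbf{x}+\alpha S^{kh}_{ij}$ nonnegative. The ERP is the two-objective problem of maximizing $[u^h(\mathbf{x}+\alpha S^{kh}_{ij}),u^k(\mathbf{x}+\alpha S^{kh}_{ij})]$ over integer feasible step lengths $\alpha$ such that neither agent's utility falls below its value at $\mathbf{x}$ (the disagreement point). A vector $v^*$ strictly dominates $v$ if $v_l\le v^*_l$ for each component and $v_l<v^*_l$ for some component; $\mathcal{V}^*$ is the set of attainable utility vectors not strictly dominated by another attainable one.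
   Formalization: In (i) the step is the lower endpoint rounded up or the upper one rounded down, since ERP steps are integers and the endpoints need not be. In (ii), if a nonzero integer step exists and Γ is nonempty, the case where exactly one of the two sign expressions is zero is excluded. *)

theory Defs
  imports "HOL-Analysis.Analysis"
begin

text \<open>
  Agents and commodities are the elements of finite types; an allocation
  \<open>x :: real ^ 'm ^ 'n\<close> has entry \<open>x $ h $ i\<close> for the amount of commodity
  \<open>i\<close> held by agent \<open>h\<close>, so that \<open>x $ h\<close> is the bundle (block) of agent \<open>h\<close>
  and \<open>norm\<close> is the Euclidean norm of the whole vector.
\<close>

definition integer_vector :: "real ^ 'm ^ 'n \<Rightarrow> bool" where
  "integer_vector v \<longleftrightarrow> (\<forall>l r. v $ l $ r \<in> \<int>)"

definition feasible_allocation ::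
  "real ^ 'm \<Rightarrow> real ^ 'n \<Rightarrow> real ^ 'n \<Rightarrow> real ^ 'm \<Rightarrow> real ^ 'm ^ 'n \<Rightarrow> bool" where
  "feasible_allocation p d b b0 x \<longleftrightarrow>
     integer_vector x \<and> (\<forall>h i. 0 \<le> x $ h $ i) \<and>
     (\<forall>h. (\<Sum>i\<in>UNIV. p $ i * x $ h $ i) = b $ h) \<and>
     (\<forall>i. (\<Sum>h\<in>UNIV. d $ h * x $ h $ i) = b0 $ i)"

definition utility :: "real ^ 'm ^ 'n \<Rightarrow> 'n \<Rightarrow> real ^ 'm ^ 'n \<Rightarrow> real" where
  "utility c l x = (\<Sum>r\<in>UNIV. c $ l $ r * x $ l $ r)"

definition direction ::
  "real ^ 'm \<Rightarrow> real ^ 'n \<Rightarrow> 'n \<Rightarrow> 'n \<Rightarrow> 'm \<Rightarrow> 'm \<Rightarrow> real ^ 'm ^ 'n" where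
  "direction p d k h i j = (\<chi> l r.
     if l = h \<and> r = i then p $ j * d $ k
     else if l = h \<and> r = j then - (p $ i * d $ k)
     else if l = k \<and> r = i then - (p $ j * d $ h)
     else if l = k \<and> r = j then p $ i * d $ h
     else 0)"

definition step_factor ::
  "real ^ 'm \<Rightarrow> real ^ 'n \<Rightarrow> 'n \<Rightarrow> 'n \<Rightarrow> 'm \<Rightarrow> 'm \<Rightarrow> real" where
  "step_factor p d k h i j = (THE F. F \<in> \<rat> \<and> 0 < F \<and>
     integer_vector (F *\<^sub>R direction p d k h i j) \<and>
     (\<forall>G>0. integer_vector (G *\<^sub>R direction p d k h i j) \<longrightarrow>
        norm (F *\<^sub>R direction p d k h i j) \<le> norm (G *\<^sub>R direction p d k h i j)))"

definition step_vector ::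
  "real ^ 'm \<Rightarrow> real ^ 'n \<Rightarrow> 'n \<Rightarrow> 'n \<Rightarrow> 'm \<Rightarrow> 'm \<Rightarrow> real ^ 'm ^ 'n" where
  "step_vector p d k h i j = step_factor p d k h i j *\<^sub>R direction p d k h i j"

text \<open>
  A linear function with nonzero slope has no maximizer on the reals; maximizing
  its extension to \<open>ereal\<close> gives the maximizer \<open>\<infinity>\<close> for positive and
  \<open>- \<infinity>\<close> for negative slope. For slope \<open>0\<close> every point is a maximizer,
  which is why the argmax is a set here; the least and the greatest element of the two
  argmaxes are then the infimum and the supremum of their union.
\<close>

definition linear_argmax :: "real \<Rightarrow> ereal set" where
  "linear_argmax s = Collect (is_arg_max (\<lambda>a. a * ereal s) (\<lambda>_. True))"

definition step_argmaxes ::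
  "real ^ 'm ^ 'n \<Rightarrow> real ^ 'm \<Rightarrow> real ^ 'n \<Rightarrow> 'n \<Rightarrow> 'n \<Rightarrow> 'm \<Rightarrow> 'm \<Rightarrow> ereal set" where
  "step_argmaxes c p d k h i j =
     linear_argmax (c $ k \<bullet> step_vector p d k h i j $ k) \<union>
     linear_argmax (c $ h \<bullet> step_vector p d k h i j $ h)"

definition a_down ::
  "real ^ 'm ^ 'n \<Rightarrow> real ^ 'm \<Rightarrow> real ^ 'n \<Rightarrow> 'n \<Rightarrow> 'n \<Rightarrow> 'm \<Rightarrow> 'm \<Rightarrow> ereal" where
  "a_down c p d k h i j = Inf (step_argmaxes c p d k h i j)"

definition a_up ::
  "real ^ 'm ^ 'n \<Rightarrow> real ^ 'm \<Rightarrow> real ^ 'n \<Rightarrow> 'n \<Rightarrow> 'n \<Rightarrow> 'm \<Rightarrow> 'm \<Rightarrow> ereal" where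
  "a_up c p d k h i j = Sup (step_argmaxes c p d k h i j)"

definition Gamma_set ::
  "real ^ 'm ^ 'n \<Rightarrow> real ^ 'm \<Rightarrow> real ^ 'n \<Rightarrow> 'n \<Rightarrow> 'n \<Rightarrow> 'm \<Rightarrow> 'm \<Rightarrow> int set" where
  "Gamma_set c p d k h i j =
     {a. ereal (of_int a) \<in> {a_down c p d k h i j .. a_up c p d k h i j}}"

text \<open>
  The interval of feasible step lengths is the one with the endpoints below. For
  \<open>x + \<alpha> S\<close> to be nonnegative the lower endpoint would have to be formed with
  \<open>min\<close> in place of \<open>max\<close>; the source has \<open>max\<close>, which is kept.
  The endpoints need not be integers: the extreme integer step lengths are
  \<open>\<lceil>alpha_down p d x k h i j\<rceil>\<close> and \<open>\<lfloor>alpha_up p d x k h i j\<rfloor>\<close>.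
\<close>

definition alpha_down ::
  "real ^ 'm \<Rightarrow> real ^ 'n \<Rightarrow> real ^ 'm ^ 'n \<Rightarrow> 'n \<Rightarrow> 'n \<Rightarrow> 'm \<Rightarrow> 'm \<Rightarrow> real" where
  "alpha_down p d x k h i j =
     - max (x $ h $ i / (p $ j * d $ k)) (x $ k $ j / (p $ i * d $ h)) / step_factor p d k h i j"

definition alpha_up ::
  "real ^ 'm \<Rightarrow> real ^ 'n \<Rightarrow> real ^ 'm ^ 'n \<Rightarrow> 'n \<Rightarrow> 'n \<Rightarrow> 'm \<Rightarrow> 'm \<Rightarrow> real" where
  "alpha_up p d x k h i j =
     min (x $ h $ j / (p $ i * d $ k)) (x $ k $ i / (p $ j * d $ h)) / step_factor p d k h i j"

definition feasible_steps ::
  "real ^ 'm \<Rightarrow> real ^ 'n \<Rightarrow> real ^ 'm ^ 'n \<Rightarrow> 'n \<Rightarrow> 'n \<Rightarrow> 'm \<Rightarrow> 'm \<Rightarrow> int set" where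
  "feasible_steps p d x k h i j =
     {a. of_int a \<in> {alpha_down p d x k h i j .. alpha_up p d x k h i j}}"

definition utility_pair ::
  "real ^ 'm ^ 'n \<Rightarrow> 'n \<Rightarrow> 'n \<Rightarrow> real ^ 'm ^ 'n \<Rightarrow> real \<times> real" where
  "utility_pair c k h x = (utility c h x, utility c k x)"

definition reallocate ::
  "real ^ 'm \<Rightarrow> real ^ 'n \<Rightarrow> real ^ 'm ^ 'n \<Rightarrow> 'n \<Rightarrow> 'n \<Rightarrow> 'm \<Rightarrow> 'm \<Rightarrow> int \<Rightarrow> real ^ 'm ^ 'n" where
  "reallocate p d x k h i j a = x + of_int a *\<^sub>R step_vector p d k h i j"

definition ERP_values ::
  "real ^ 'm ^ 'n \<Rightarrow> real ^ 'm \<Rightarrow> real ^ 'n \<Rightarrow> real ^ 'm ^ 'n \<Rightarrow> 'n \<Rightarrow> 'n \<Rightarrow> 'm \<Rightarrow> 'm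
     \<Rightarrow> (real \<times> real) set" where
  "ERP_values c p d x k h i j =
     {utility_pair c k h (reallocate p d x k h i j a) | a.
        a \<in> feasible_steps p d x k h i j \<and>
        utility c h x \<le> utility c h (reallocate p d x k h i j a) \<and>
        utility c k x \<le> utility c k (reallocate p d x k h i j a)}"

definition strictly_dominates :: "real \<times> real \<Rightarrow> real \<times> real \<Rightarrow> bool" where
  "strictly_dominates w v \<longleftrightarrow>
     fst v \<le> fst w \<and> snd v \<le> snd w \<and> (fst v < fst w \<or> snd v < snd w)"

definition ERP_efficient ::
  "real ^ 'm ^ 'n \<Rightarrow> real ^ 'm \<Rightarrow> real ^ 'n \<Rightarrow> real ^ 'm ^ 'n \<Rightarrow> 'n \<Rightarrow> 'n \<Rightarrow> 'm \<Rightarrow> 'm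
     \<Rightarrow> (real \<times> real) set" where
  "ERP_efficient c p d x k h i j =
     {v \<in> ERP_values c p d x k h i j.
        \<not> (\<exists>w \<in> ERP_values c p d x k h i j. strictly_dominates w v)}"

end

theory Submission
  imports Defs
begin

text \<open>
  Along the step vector both utilities are linear in the step length, with slopes \<open>F * gh\<close>
  and \<open>F * gk\<close>. The interval of feasible step lengths contains \<open>0\<close>, so among the feasible steps
  that hurt neither agent one is best for both agents at once: the rightmost step if no slope
  is negative, the leftmost if no slope is positive, and \<open>0\<close> if the slopes have opposite signs.
  Hence the attainable utility vectors always have a greatest element, which is the only
  efficient one.
\<close>

section \<open>Positivity of the step factor\<close>

text \<open>Denominators multiply up one element at a time. Applied to the four possible nonzero
  entries of \<open>direction\<close>, this supplies at least one positive integral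
  multiple.\<close>

lemma common_denominator_exists:
  fixes A :: "real set"
  assumes "finite A" and "A \<subseteq> \<rat>"
  shows "\<exists>n::nat. 0 < n \<and> (\<forall>a\<in>A. of_nat n * a \<in> \<int>)"
  using assms
proof (induction A rule: finite_induct)
  case empty
  show ?case by auto
next
  case (insert q A)
  then obtain n :: nat where n: "0 < n" "\<forall>a\<in>A. of_nat n * a \<in> \<int>"
    by auto
  from insert.prems obtain a b where ab: "0 < b" "q = of_int a / of_int b"
    by (metis Rats_cases' insert_subset)
  have bq: "of_nat (nat b) * q = of_int a"
    using ab by simp
  have "of_nat (n * nat b) * e \<in> \<int>" if "e \<in> insert q A" for e
  proof (cases "e = q")
    case True
    have "of_nat (n * nat b) * e = of_nat n * of_int a"
      unfolding True bq [symmetric] by simp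
    then show ?thesis by (metis Ints_mult Ints_of_int Ints_of_nat)
  next
    case False
    with that n have "of_nat n * e \<in> \<int>" by simp
    moreover have "of_nat (n * nat b) * e = of_nat (nat b) * (of_nat n * e)"
      by simp
    ultimately show ?thesis by (metis Ints_mult Ints_of_nat)
  qed
  then show ?case
    using n(1) ab(1) by (intro exI [of _ "n * nat b"]) auto
qed

text \<open>Since \<open>step_factor\<close> is a definite description, its sign is known only after
  existence and uniqueness. The norm of \<open>F *\<^sub>R ?D\<close> grows strictly with
  \<open>F > 0\<close>, so the least norm belongs to the least admissible factor.\<close>

lemma step_factor_pos:
  fixes p :: "real ^ 'm" and d :: "real ^ 'n"
  assumes p: "\<And>r. p $ r \<in> \<rat> \<and> 0 < p $ r"
    and d: "\<And>l. d $ l \<in> \<rat> \<and> 0 < d $ l"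
  shows "0 < step_factor p d k h i j"
proof -
  let ?D = "direction p d k h i j"
  define r where "r = p $ j * d $ k"
  have r: "0 < r" "r \<in> \<rat>"
    using p d by (auto simp: r_def)
  have Dhi: "?D $ h $ i = r"
    by (simp add: direction_def r_def)
  then have nD: "0 < norm ?D"
    using r by auto
  \<comment> \<open>Integrality of the single entry \<open>r\<close> already forces \<open>G\<close>
    into the discrete set of positive multiples of \<open>1 / r\<close>, so a least admissible
    factor exists by well-ordering of the naturals.\<close>
  have quantised: "\<exists>m::nat. 0 < m \<and> G = of_nat m / r"
    if "0 < G" "integer_vector (G *\<^sub>R ?D)" for G
  proof -
    have "G * r \<in> \<int>"
      using that(2) Dhi unfolding integer_vector_def by (metis real_scaleR_def vector_scaleR_component)
    then obtain z where z: "G * r = of_int z"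
      by (auto elim: Ints_cases)
    moreover have "0 < G * r" using that(1) r(1) by simp
    ultimately have "0 < z" by simp
    then show ?thesis
      using z r(1) by (intro exI [of _ "nat z"]) (auto simp: field_simps)
  qed
  let ?A = "{p $ j * d $ k, - (p $ i * d $ k), - (p $ j * d $ h), p $ i * d $ h}"
  obtain n :: nat where n: "0 < n" "\<forall>a\<in>?A. of_nat n * a \<in> \<int>"
    using common_denominator_exists [of ?A] p d by auto
  have int_n: "integer_vector (of_nat n *\<^sub>R ?D)"
    using n(2) by (auto simp: integer_vector_def direction_def)
  define P where "P m \<longleftrightarrow> 0 < m \<and> integer_vector ((of_nat m / r) *\<^sub>R ?D)" for m :: nat
  have exP: "\<exists>m. P m"
    using quantised [OF _ int_n] int_n n(1) unfolding P_def by auto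
  define F where "F = of_nat (Least P) / r"
  have PL: "P (Least P)" using LeastI_ex [OF exP] .
  have F: "F \<in> \<rat>" "0 < F" "integer_vector (F *\<^sub>R ?D)"
    using PL r by (auto simp: F_def P_def)
  have F_le: "F \<le> G" if "0 < G" "integer_vector (G *\<^sub>R ?D)" for G
  proof -
    from quantised [OF that] obtain m :: nat where m: "0 < m" "G = of_nat m / r"
      by auto
    then have "Least P \<le> m"
      using that by (intro Least_le) (auto simp: P_def)
    then show ?thesis
      using r(1) by (simp add: F_def m(2) divide_right_mono)
  qed
  have "step_factor p d k h i j = F"
    unfolding step_factor_def
  proof (rule the_equality)
    show "F \<in> \<rat> \<and> 0 < F \<and> integer_vector (F *\<^sub>R ?D) \<and>
        (\<forall>G>0. integer_vector (G *\<^sub>R ?D) \<longrightarrow> norm (F *\<^sub>R ?D) \<le> norm (G *\<^sub>R ?D))"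
      using F F_le by (auto simp: intro!: mult_right_mono)
  next
    fix G
    assume G: "G \<in> \<rat> \<and> 0 < G \<and> integer_vector (G *\<^sub>R ?D) \<and>
        (\<forall>G'>0. integer_vector (G' *\<^sub>R ?D) \<longrightarrow> norm (G *\<^sub>R ?D) \<le> norm (G' *\<^sub>R ?D))"
    then have "norm (G *\<^sub>R ?D) \<le> norm (F *\<^sub>R ?D)"
      using F by blast
    then have "G \<le> F"
      using nD F(2) G by simp
    then show "G = F"
      using F_le G by force
  qed
  then show ?thesis using F(2) by simp
qed

section \<open>Slopes of the utilities\<close>

lemma inner_direction_left:
  fixes c :: "real ^ 'm ^ 'n"
  assumes "i \<noteq> j"
  shows "c $ h \<bullet> direction p d k h i j $ h
    = c $ h $ i * p $ j * d $ k - c $ h $ j * p $ i * d $ k"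
proof -
  \<comment> \<open>Because \<open>i \<noteq> j\<close>, the nested conditionals split into a sum of
    two indicator terms, each of which collapses under summation.\<close>
  have "c $ h \<bullet> direction p d k h i j $ h
      = (\<Sum>r\<in>UNIV. (if r = i then c $ h $ i * (p $ j * d $ k) else 0)
          + (if r = j then c $ h $ j * (- (p $ i * d $ k)) else 0))"
    unfolding inner_vec_def using assms
    by (intro sum.cong) (auto simp: direction_def)
  then show ?thesis
    by (simp add: sum.distrib)
qed

lemma inner_direction_right:
  fixes c :: "real ^ 'm ^ 'n"
  assumes "i \<noteq> j" and "h \<noteq> k"
  shows "c $ k \<bullet> direction p d k h i j $ k
    = c $ k $ j * p $ i * d $ h - c $ k $ i * p $ j * d $ h"
proof -
  have "c $ k \<bullet> direction p d k h i j $ k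
      = (\<Sum>r\<in>UNIV. (if r = i then c $ k $ i * (- (p $ j * d $ h)) else 0)
          + (if r = j then c $ k $ j * (p $ i * d $ h) else 0))"
    unfolding inner_vec_def using assms
    by (intro sum.cong) (auto simp: direction_def)
  then show ?thesis
    by (simp add: sum.distrib)
qed

lemma utility_reallocate:
  "utility c l (reallocate p d x k h i j a)
    = utility c l x + of_int a * (c $ l \<bullet> step_vector p d k h i j $ l)"
  by (simp add: utility_def reallocate_def inner_vec_def sum.distrib sum_distrib_left algebra_simps)

section \<open>Argmaxes and the set of integer points between them\<close>

lemma linear_argmax_pos:
  assumes "0 < s"
  shows "linear_argmax s = {\<infinity>}"
proof -
  have "a = \<infinity>" if "is_arg_max (\<lambda>a. a * ereal s) (\<lambda>_. True) a" for a
    using that [unfolded is_arg_max_def] assms by (cases a) (auto dest: spec [of _ \<infinity>])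
  moreover have "is_arg_max (\<lambda>a. a * ereal s) (\<lambda>_. True) \<infinity>"
    using assms by (simp add: is_arg_max_def)
  ultimately show ?thesis
    unfolding linear_argmax_def by blast
qed

lemma linear_argmax_neg:
  assumes "s < 0"
  shows "linear_argmax s = {-\<infinity>}"
proof -
  have "a = -\<infinity>" if "is_arg_max (\<lambda>a. a * ereal s) (\<lambda>_. True) a" for a
    using that [unfolded is_arg_max_def] assms by (cases a) (auto dest: spec [of _ "-\<infinity>"])
  moreover have "is_arg_max (\<lambda>a. a * ereal s) (\<lambda>_. True) (-\<infinity>)"
    using assms by (simp add: is_arg_max_def)
  ultimately show ?thesis
    unfolding linear_argmax_def by blast
qed

text \<open>In \<open>ereal\<close> also \<infinity> * 0 = 0, so both infinite points are
  maximizers; a single vanishing slope therefore already stretches the interval to all of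
  \<open>ereal\<close>.\<close>

lemma linear_argmax_zero: "linear_argmax 0 = UNIV"
  unfolding linear_argmax_def is_arg_max_def zero_ereal_def [symmetric] by simp

text \<open>The interval misses the integers only if it degenerates to one infinite point, that is,
  if both slopes are nonzero with the same sign. Otherwise both infinities occur among the
  argmaxes.\<close>

lemma Gamma_set_eq:
  fixes c :: "real ^ 'm ^ 'n"
  assumes sh: "sh = c $ h \<bullet> step_vector p d k h i j $ h"
    and sk: "sk = c $ k \<bullet> step_vector p d k h i j $ k"
  shows "Gamma_set c p d k h i j = (if sh * sk > 0 then {} else UNIV)"
proof -
  have args: "step_argmaxes c p d k h i j = linear_argmax sk \<union> linear_argmax sh"
    by (simp add: step_argmaxes_def sh sk)
  have full: "Gamma_set c p d k h i j = UNIV"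
    if "-\<infinity> \<in> step_argmaxes c p d k h i j" "\<infinity> \<in> step_argmaxes c p d k h i j"
    using Inf_lower [OF that(1)] Sup_upper [OF that(2)]
    by (simp add: Gamma_set_def a_down_def a_up_def)
  have single: "Gamma_set c p d k h i j = {}"
    if "step_argmaxes c p d k h i j = {e}" "\<bar>e\<bar> = \<infinity>" for e
    using that(2) by (auto simp: Gamma_set_def a_down_def a_up_def that(1))
  consider "sh = 0 \<or> sk = 0" | "sh < 0" "sk < 0" | "sh > 0" "sk > 0"
    | "sh < 0" "sk > 0" | "sh > 0" "sk < 0"
    by linarith
  then show ?thesis
  proof cases
    case 1
    then show ?thesis by (auto intro!: full simp: args linear_argmax_zero)
  next
    case 2
    then show ?thesis
      by (simp add: single [of "-\<infinity>"] args linear_argmax_neg mult_neg_neg)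
  next
    case 3
    then show ?thesis
      by (simp add: single [of \<infinity>] args linear_argmax_pos)
  next
    case 4
    then show ?thesis
      by (simp add: full args linear_argmax_pos linear_argmax_neg zero_less_mult_iff)
  next
    case 5
    then show ?thesis
      by (simp add: full args linear_argmax_pos linear_argmax_neg zero_less_mult_iff)
  qed
qed

section \<open>Efficient points of the two-agent problem\<close>

text \<open>A componentwise greatest attainable vector strictly dominates every other one and is
  dominated by none.\<close>

lemma ERP_efficient_eq_singleton:
  assumes "w \<in> ERP_values c p d x k h i j"
    and "\<And>v. v \<in> ERP_values c p d x k h i j \<Longrightarrow> fst v \<le> fst w \<and> snd v \<le> snd w"
  shows "ERP_efficient c p d x k h i j = {w}"
proof -
  have "strictly_dominates w v" if "v \<in> ERP_values c p d x k h i j" "v \<noteq> w" for v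
    using assms(2) [OF that(1)] that(2) by (auto simp: strictly_dominates_def prod_eq_iff)
  moreover have "\<not> strictly_dominates v w" if "v \<in> ERP_values c p d x k h i j" for v
    using assms(2) [OF that] by (auto simp: strictly_dominates_def)
  ultimately show ?thesis
    using assms(1) unfolding ERP_efficient_def by blast
qed

text \<open>By linearity the disagreement constraints and all utility comparisons become
  inequalities between multiples of the two slopes.\<close>

lemma ERP_efficient_at_step:
  fixes c :: "real ^ 'm ^ 'n"
  assumes sh: "sh = c $ h \<bullet> step_vector p d k h i j $ h"
    and sk: "sk = c $ k \<bullet> step_vector p d k h i j $ k"
    and a: "a \<in> feasible_steps p d x k h i j" "0 \<le> of_int a * sh" "0 \<le> of_int a * sk"
    and best: "\<And>e. e \<in> feasible_steps p d x k h i j \<Longrightarrow> 0 \<le> of_int e * sh \<Longrightarrow> 0 \<le> of_int e * sk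
      \<Longrightarrow> of_int e * sh \<le> of_int a * sh \<and> of_int e * sk \<le> of_int a * sk"
  shows "ERP_efficient c p d x k h i j = {utility_pair c k h (reallocate p d x k h i j a)}"
proof (rule ERP_efficient_eq_singleton)
  show "utility_pair c k h (reallocate p d x k h i j a) \<in> ERP_values c p d x k h i j"
    using a by (auto simp: ERP_values_def utility_reallocate sh sk)
qed (use best in \<open>auto simp: ERP_values_def utility_pair_def utility_reallocate sh sk\<close>)

lemma feasible_steps_iff:
  "a \<in> feasible_steps p d x k h i j
    \<longleftrightarrow> \<lceil>alpha_down p d x k h i j\<rceil> \<le> a \<and> a \<le> \<lfloor>alpha_up p d x k h i j\<rfloor>"
  by (simp add: feasible_steps_def ceiling_le_iff le_floor_iff)

theorem corollary2:
  fixes c x :: "real ^ 'm ^ 'n" and p b0 :: "real ^ 'm" and d b :: "real ^ 'n"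
    and h k :: 'n and i j :: 'm
    and gh gk lo up :: real and \<Gamma> :: "int set" and V :: "(real \<times> real) set"
  assumes "\<And>r. p $ r \<in> \<rat> \<and> 0 < p $ r"
    and "\<And>l. d $ l \<in> \<rat> \<and> 0 < d $ l"
    and "\<And>l. b $ l \<in> \<rat>"
    and "\<And>r. b0 $ r \<in> \<rat>"
    and "h \<noteq> k" and "i \<noteq> j"
    and "feasible_allocation p d b b0 x"
    and gh: "gh = c $ h $ i * p $ j * d $ k - c $ h $ j * p $ i * d $ k"
    and gk: "gk = c $ k $ j * p $ i * d $ h - c $ k $ i * p $ j * d $ h"
    and lo: "lo = alpha_down p d x k h i j"
    and up: "up = alpha_up p d x k h i j"
    and \<Gamma>: "\<Gamma> = Gamma_set c p d k h i j"
    and V: "V = ERP_efficient c p d x k h i j"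
  shows "(\<Gamma> = UNIV \<or> \<Gamma> = {})
    \<and> (gh * gk < 0 \<longrightarrow> \<Gamma> = UNIV)
    \<and> (gh * gk > 0 \<longrightarrow> \<Gamma> = {})
    \<and> (\<forall>v\<in>V. \<forall>w\<in>V. v = w)
    \<and> ((\<exists>z::int. z \<noteq> 0 \<and> lo \<le> of_int z \<and> of_int z \<le> up) \<and> \<Gamma> = {} \<longrightarrow>
         (gh < 0 \<and> gk < 0 \<and> V = {utility_pair c k h (reallocate p d x k h i j \<lceil>lo\<rceil>)}) \<or>
         (gh > 0 \<and> gk > 0 \<and> V = {utility_pair c k h (reallocate p d x k h i j \<lfloor>up\<rfloor>)}))
    \<and> (\<not> (\<exists>z::int. z \<noteq> 0 \<and> lo \<le> of_int z \<and> of_int z \<le> up) \<or>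
         (\<Gamma> \<noteq> {} \<and> (gh = 0 \<longleftrightarrow> gk = 0)) \<longrightarrow>
         V = {utility_pair c k h x})"
proof -
  let ?lo = "\<lceil>lo\<rceil>" and ?up = "\<lfloor>up\<rfloor>"
  let ?R = "\<lambda>a. utility_pair c k h (reallocate p d x k h i j a)"
  define F where "F = step_factor p d k h i j"
  have F: "0 < F"
    unfolding F_def using assms(1,2) by (rule step_factor_pos)
  define sh where "sh = c $ h \<bullet> step_vector p d k h i j $ h"
  define sk where "sk = c $ k \<bullet> step_vector p d k h i j $ k"
  have sh: "sh = F * gh"
    using \<open>i \<noteq> j\<close> by (simp add: sh_def gh F_def step_vector_def inner_direction_left)
  have sk: "sk = F * gk"
    using \<open>i \<noteq> j\<close> \<open>h \<noteq> k\<close> by (simp add: sk_def gk F_def step_vector_def inner_direction_right)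
  have sign: "0 < sh \<longleftrightarrow> 0 < gh" "sh < 0 \<longleftrightarrow> gh < 0" "0 < sk \<longleftrightarrow> 0 < gk" "sk < 0 \<longleftrightarrow> gk < 0"
    using F by (auto simp: sh sk zero_less_mult_iff mult_less_0_iff)
  have x: "0 \<le> x $ l $ r" for l r
    using assms(7) by (simp add: feasible_allocation_def)
  have pos: "0 < p $ r * d $ l" for r l
    using assms(1,2) by simp
  \<comment> \<open>Nonnegativity of the allocation \<open>x\<close> makes the zero step
    feasible.\<close>
  have "lo \<le> 0"
    using F x pos by (simp add: lo alpha_down_def F_def divide_nonneg_pos le_max_iff_disj)
  moreover have "0 \<le> up"
    using F x pos by (simp add: up alpha_up_def F_def divide_nonneg_pos)
  ultimately have zero: "?lo \<le> 0" "0 \<le> ?up"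
    by (simp_all add: ceiling_le_iff)
  \<comment> \<open>The added fact \<open>?lo \<le> ?up\<close> makes both rounded endpoints
    feasible steps.\<close>
  note zero = zero order_trans [OF zero]
  note steps = feasible_steps_iff [of _ p d x k h i j, folded lo up]
  note at_step = ERP_efficient_at_step [OF sh_def sk_def, of _ x, folded V, unfolded steps]
  have V_up: "V = {?R ?up}" if "0 \<le> sh" "0 \<le> sk"
    using that zero by (intro at_step) (auto intro: mult_right_mono)
  have V_lo: "V = {?R ?lo}" if "sh \<le> 0" "sk \<le> 0"
    using that zero by (intro at_step) (auto intro: mult_right_mono_neg mult_nonpos_nonpos)
  \<comment> \<open>Any nonzero step makes one of the agents worse off, so only the zero step is
    admissible.\<close>
  have V_0: "V = {?R 0}" if "sh < 0 \<and> 0 < sk \<or> 0 < sh \<and> sk < 0"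
    using that zero by (intro at_step) (auto simp: zero_le_mult_iff)
  have R_0: "?R 0 = utility_pair c k h x"
    by (simp add: utility_pair_def utility_reallocate)
  \<comment> \<open>Both rounded endpoints are themselves integers between \<open>lo\<close> and
    \<open>up\<close>.\<close>
  have steps_zero: "?up = 0" "?lo = 0" if "\<not> (\<exists>z::int. z \<noteq> 0 \<and> lo \<le> of_int z \<and> of_int z \<le> up)"
    using that zero by (auto simp flip: ceiling_le_iff le_floor_iff)
  have Gamma: "\<Gamma> = (if gh * gk > 0 then {} else UNIV)"
    unfolding \<Gamma> Gamma_set_eq [OF sh_def sk_def] using sign
    by (simp add: zero_less_mult_iff)
  have V_cases: "V = {?R ?up} \<or> V = {?R ?lo} \<or> V = {?R 0}"
    using V_up V_lo V_0 by linarith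
  then have V_single: "\<forall>v\<in>V. \<forall>w\<in>V. v = w"
    by (elim disjE) simp_all
  have case_i: "(gh < 0 \<and> gk < 0 \<and> V = {?R ?lo}) \<or> (gh > 0 \<and> gk > 0 \<and> V = {?R ?up})"
    if "\<Gamma> = {}"
  proof -
    have "gh * gk > 0"
      using that Gamma by (auto split: if_splits)
    then show ?thesis
      using V_up V_lo sign by (auto simp: zero_less_mult_iff)
  qed
  have case_ii_steps: "V = {utility_pair c k h x}"
    if "\<not> (\<exists>z::int. z \<noteq> 0 \<and> lo \<le> of_int z \<and> of_int z \<le> up)"
    using V_cases unfolding steps_zero [OF that] R_0 by blast
  \<comment> \<open>If exactly one slope vanished, \<Gamma> would be all of the integers, yet an
    endpoint step could still benefit the other agent; the equivalence rules this out.\<close>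
  have case_ii_Gamma: "V = {utility_pair c k h x}"
    if "\<Gamma> \<noteq> {}" "gh = 0 \<longleftrightarrow> gk = 0"
  proof (cases "gh = 0")
    case True
    then have "sh = 0" "sk = 0"
      using that(2) sh sk by auto
    \<comment> \<open>With both slopes zero, the endpoint step \<open>?up\<close> leaves the
      utilities at the disagreement point.\<close>
    then show ?thesis
      using V_up by (simp add: utility_pair_def utility_reallocate flip: sh_def sk_def)
  next
    case False
    with that have "gk \<noteq> 0" "\<not> gh * gk > 0"
      using Gamma by auto
    with False have "sh < 0 \<and> 0 < sk \<or> 0 < sh \<and> sk < 0"
      unfolding sign by (auto simp: zero_less_mult_iff)
    then show ?thesis using V_0 R_0 by simp
  qed
  show ?thesis
  proof (intro conjI impI)
    show "\<Gamma> = UNIV \<or> \<Gamma> = {}" "gh * gk < 0 \<Longrightarrow> \<Gamma> = UNIV" "gh * gk > 0 \<Longrightarrow> \<Gamma> = {}"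
      by (simp_all add: Gamma)
  qed (use V_single in assumption, erule conjE, erule case_i,
      elim disjE conjE case_ii_steps, rule case_ii_Gamma)
qed

end
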